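(* Let $\Omega\subset\mathbb{R}^N$ ($N\ge 1$) be a bounded open set with a Lipschitz continuous boundary and satisfying the exterior ball condition, let $0<s<1$, $T>0$, $Q:=(0,T)\times\Omega$, and let $2\le p<\infty$, $2\le r<\infty$ satisfy $1>\frac{N}{2ps}+\frac1r$. Let $Z:=L^r((0,T);L^p(\Omega))$, let $Z_{ad}\subset Z$ be nonempty, closed and convex, let $u_d\in L^2(Q)$, $\alpha>0$, $0\le\hat\mu\in L^2(Q)$, and for $\gamma>0$ let $(\bar u^\gamma,\bar z^\gamma)$ denote the solution of the regularized problem $$\min_{(u,z)\in U\times Z}\ \tfrac12\|u-u_d\|^2_{L^2(Q)}+\tfrac\alpha2\|z\|^2_{L^2(Q)}+\tfrac1{2\gamma}\|(\hat\mu+\gamma u)_+\|^2_{L^2(Q)}$$ $$\text{subject to}\quad \partial_tu+(-\Delta)^s_Du=z\ \text{in }Q,\quad u(0,\cdot)=0\ \text{in }\Omega,\quad z\in Z_{ad}.$$ If $0\in Z_{ad}$ and $u_d\ge0$ a.e. in $Q$, then $\|(\bar u^\gamma)_+\|_{L^2(Q)}=\mathcal{O}(\gamma^{-1})$ as $\gamma\to\infty$.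
   Context: $(\cdot)_+:=\max\{0,\cdot\}$. The problem is the Moreau--Yosida regularization of the state-constrained problem with constraint $u\le u_b\equiv0$ in $\overline Q$; the function $\hat\mu$ is fixed, independent of $\gamma$. $\widetilde W^{s,2}_0(\Omega):=\{u\in W^{s,2}(\mathbb{R}^N): u=0 \text{ in }\mathbb{R}^N\setminus\Omega\}$, where $W^{s,2}(\mathbb{R}^N)$ is the space of $u\in L^2(\mathbb{R}^N)$ with $\int_{\mathbb{R}^N}\int_{\mathbb{R}^N}\frac{|u(x)-u(y)|^2}{|x-y|^{N+2s}}\,dx\,dy<\infty$; $\widetilde W^{-s,2}(\Omega)$ is its dual with respect to the pivot space $L^2(\Omega)$; $\mathbb{U}_0:=L^2((0,T);\widetilde W^{s,2}_0(\Omega))\cap H^1((0,T);\widetilde W^{-s,2}(\Omega))$. $(-\Delta)^su(x)=C_{N,s}\,\mathrm{P.V.}\int_{\mathbb{R}^N}\frac{u(x)-u(y)}{|x-y|^{N+2s}}\,dy$ with $C_{N,s}=\frac{s2^{2s}\Gamma(\frac{2s+N}{2})}{\pi^{N/2}\Gamma(1-s)}$. $(-\Delta)^s_D$ is its realization in $L^2(\Omega)$ with zero exterior condition $u=0$ in $\mathbb{R}^N\setminus\Omega$, also viewed as a bounded operator $\widetilde W^{s,2}_0(\Omega)\to\widetilde W^{-s,2}(\Omega)$ via $\langle(-\Delta)^s_Du,v\rangle=\mathcal{E}(u,v):=\frac{C_{N,s}}2\int_{\mathbb{R}^N}\int_{\mathbb{R}^N}\frac{(u(x)-u(y))(v(x)-v(y))}{|x-y|^{N+2s}}\,dx\,dy$.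 $U:=\{u\in\mathbb{U}_0\cap C(\overline Q):(\partial_t+(-\Delta)^s_D)(u|_\Omega)\in L^r((0,T);L^p(\Omega))\}$. The state equation is understood in the weak sense: $u\in\mathbb{U}_0$, $u(0,\cdot)=0$ a.e. in $\Omega$, and $\langle\partial_tu,v\rangle+\mathcal{E}(u,v)=\langle z,v\rangle$ for every $v\in\widetilde W^{s,2}_0(\Omega)$ and a.e. $t\in(0,T)$, with pairings between $\widetilde W^{-s,2}(\Omega)$ and $\widetilde W^{s,2}_0(\Omega)$. *)

theory Defs
  imports
    "HOL-Analysis.Analysis"
    "HOL-Library.Landau_Symbols"
    "HOL-Library.Function_Algebras"
begin

text \<open>
  Conventions.  The space \<open>R^N\<close> is a Euclidean space \<open>'a\<close> with \<open>N = DIM('a)\<close>.  Elements of Lebesgue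
  and Sobolev spaces are Lebesgue measurable representatives, so that the norms below are seminorms
  on spaces of functions, vanishing exactly on the functions that represent zero.  A space-time
  function is a function \<open>u\<close> of the pair \<open>(t, x)\<close>, and \<open>curry u\<close> is the
  corresponding function of time with values in a space of functions of \<open>x\<close>.
\<close>

section \<open>The domain\<close>

text \<open>Near each boundary point, \<open>\<Omega>\<close> is the region strictly above the graph of a Lipschitz function,
  in coordinates whose last axis is the unit vector \<open>e\<close>; the graph lives over the hyperplane
  orthogonal to \<open>e\<close>.\<close>

definition lipschitz_boundary :: "'a::euclidean_space set \<Rightarrow> bool" where
  "lipschitz_boundary \<Omega> \<longleftrightarrow>
     (\<forall>x0\<in>frontier \<Omega>. \<exists>e \<rho> L \<psi>. norm e = 1 \<and> 0 < \<rho> \<and>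
        L-lipschitz_on {y. y \<bullet> e = 0} (\<psi> :: 'a \<Rightarrow> real) \<and>
        \<Omega> \<inter> ball x0 \<rho> = {y \<in> ball x0 \<rho>. \<psi> (y - (y \<bullet> e) *\<^sub>R e) < y \<bullet> e})"

definition exterior_ball_condition :: "'a::euclidean_space set \<Rightarrow> bool" where
  "exterior_ball_condition \<Omega> \<longleftrightarrow>
     (\<forall>x0\<in>frontier \<Omega>. \<exists>y \<rho>. 0 < \<rho> \<and> cball y \<rho> \<inter> closure \<Omega> = {x0})"

definition space_time_cylinder :: "real \<Rightarrow> 'a::euclidean_space set \<Rightarrow> (real \<times> 'a) set" where
  "space_time_cylinder T \<Omega> = {0<..<T} \<times> \<Omega>"


section \<open>Lebesgue and Lebesgue--Bochner spaces\<close>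

definition Lp :: "real \<Rightarrow> 'b::euclidean_space set \<Rightarrow> ('b \<Rightarrow> real) set" where
  "Lp p A = {f \<in> borel_measurable (lebesgue_on A).
               integrable (lebesgue_on A) (\<lambda>x. \<bar>f x\<bar> powr p)}"

definition Lp_norm :: "real \<Rightarrow> 'b::euclidean_space set \<Rightarrow> ('b \<Rightarrow> real) \<Rightarrow> real" where
  "Lp_norm p A f = (LINT x|lebesgue_on A. \<bar>f x\<bar> powr p) powr (1 / p)"

definition L2_pairing :: "'b::euclidean_space set \<Rightarrow> ('b \<Rightarrow> real) \<Rightarrow> ('b \<Rightarrow> real) \<Rightarrow> real" where
  "L2_pairing A f g = (LINT x|lebesgue_on A. f x * g x)"

text \<open>Here \<open>V\<close> is a set of functions that is a normed space (after identification) with norm \<open>\<nu>\<close>.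
  Strong measurability: almost everywhere limit, in the norm of \<open>V\<close>, of measurable functions with
  finitely many values in \<open>V\<close>.\<close>

definition strongly_measurable_on ::
  "real \<Rightarrow> ('v::minus) set \<Rightarrow> ('v \<Rightarrow> real) \<Rightarrow> (real \<Rightarrow> 'v) \<Rightarrow> bool" where
  "strongly_measurable_on T V \<nu> f \<longleftrightarrow>
     (\<exists>S :: nat \<Rightarrow> real \<Rightarrow> 'v.
        (\<forall>n. simple_function (lebesgue_on {0<..<T}) (S n) \<and> S n ` {0<..<T} \<subseteq> V) \<and>
        (AE t in lebesgue_on {0<..<T}. (\<lambda>n. \<nu> (S n t - f t)) \<longlonglongrightarrow> 0))"

definition Bochner_Lp ::
  "real \<Rightarrow> real \<Rightarrow> ('v::minus) set \<Rightarrow> ('v \<Rightarrow> real) \<Rightarrow> (real \<Rightarrow> 'v) set" where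
  "Bochner_Lp q T V \<nu> =
     {f. (AE t in lebesgue_on {0<..<T}. f t \<in> V) \<and> strongly_measurable_on T V \<nu> f \<and>
         integrable (lebesgue_on {0<..<T}) (\<lambda>t. \<nu> (f t) powr q)}"

definition Bochner_norm :: "real \<Rightarrow> real \<Rightarrow> ('v \<Rightarrow> real) \<Rightarrow> (real \<Rightarrow> 'v) \<Rightarrow> real" where
  "Bochner_norm q T \<nu> f = (LINT t|lebesgue_on {0<..<T}. \<nu> (f t) powr q) powr (1 / q)"

text \<open>The space \<open>L^r((0,T); L^p(\<Omega>))\<close>; joint measurability selects good representatives, which exist
  in every class.\<close>

definition LrLp ::
  "real \<Rightarrow> real \<Rightarrow> real \<Rightarrow> 'a::euclidean_space set \<Rightarrow> (real \<times> 'a \<Rightarrow> real) set" where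
  "LrLp r p T \<Omega> =
     {z \<in> borel_measurable (lebesgue_on (space_time_cylinder T \<Omega>)).
        curry z \<in> Bochner_Lp r T (Lp p \<Omega>) (Lp_norm p \<Omega>)}"

definition LrLp_norm ::
  "real \<Rightarrow> real \<Rightarrow> real \<Rightarrow> 'a::euclidean_space set \<Rightarrow> (real \<times> 'a \<Rightarrow> real) \<Rightarrow> real" where
  "LrLp_norm r p T \<Omega> z = Bochner_norm r T (Lp_norm p \<Omega>) (curry z)"

definition norm_closed_in ::
  "('v::minus) set \<Rightarrow> ('v \<Rightarrow> real) \<Rightarrow> 'v set \<Rightarrow> bool" where
  "norm_closed_in V \<nu> A \<longleftrightarrow> (\<forall>z\<in>V. (\<forall>\<epsilon>>0. \<exists>y\<in>A. \<nu> (y - z) < \<epsilon>) \<longrightarrow> z \<in> A)"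

definition convex_function_set :: "('b \<Rightarrow> real) set \<Rightarrow> bool" where
  "convex_function_set A \<longleftrightarrow>
     (\<forall>f\<in>A. \<forall>g\<in>A. \<forall>\<theta>\<in>{0..1}. (\<lambda>x. (1 - \<theta>) * f x + \<theta> * g x) \<in> A)"


section \<open>Fractional Sobolev spaces and the fractional Laplacian\<close>

definition gagliardo_kernel :: "real \<Rightarrow> 'a::euclidean_space \<Rightarrow> 'a \<Rightarrow> real" where
  "gagliardo_kernel s x y = 1 / norm (x - y) powr (real DIM('a) + 2 * s)"

definition Ws2 :: "real \<Rightarrow> ('a::euclidean_space \<Rightarrow> real) set" where
  "Ws2 s = {u \<in> Lp 2 UNIV.
              integrable lebesgue
                (\<lambda>(x::'a, y). \<bar>u x - u y\<bar>\<^sup>2 * gagliardo_kernel s x y)}"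

definition Ws2_norm :: "real \<Rightarrow> ('a::euclidean_space \<Rightarrow> real) \<Rightarrow> real" where
  "Ws2_norm s u =
     sqrt ((LINT x|lebesgue. \<bar>u x\<bar>\<^sup>2)
         + (LINT (x, y)|lebesgue. \<bar>u x - u y\<bar>\<^sup>2 * gagliardo_kernel s x y))"

definition Ws2_0 :: "real \<Rightarrow> 'a::euclidean_space set \<Rightarrow> ('a \<Rightarrow> real) set" where
  "Ws2_0 s \<Omega> = {u \<in> Ws2 s. AE x in lebesgue. x \<notin> \<Omega> \<longrightarrow> u x = 0}"

text \<open>The dual of \<open>Ws2_0 s \<Omega>\<close>: only the values of a functional on \<open>Ws2_0 s \<Omega>\<close> are relevant.\<close>

definition Ws2_dual :: "real \<Rightarrow> 'a::euclidean_space set \<Rightarrow> (('a \<Rightarrow> real) \<Rightarrow> real) set" where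
  "Ws2_dual s \<Omega> =
     {f. (\<forall>u\<in>Ws2_0 s \<Omega>. \<forall>v\<in>Ws2_0 s \<Omega>. \<forall>a b.
            f (\<lambda>x. a * u x + b * v x) = a * f u + b * f v) \<and>
         (\<exists>C. \<forall>v\<in>Ws2_0 s \<Omega>. \<bar>f v\<bar> \<le> C * Ws2_norm s v)}"

definition Ws2_dual_norm ::
  "real \<Rightarrow> 'a::euclidean_space set \<Rightarrow> (('a \<Rightarrow> real) \<Rightarrow> real) \<Rightarrow> real" where
  "Ws2_dual_norm s \<Omega> f = (SUP v\<in>{v \<in> Ws2_0 s \<Omega>. Ws2_norm s v \<le> 1}. \<bar>f v\<bar>)"

definition frac_lap_const :: "nat \<Rightarrow> real \<Rightarrow> real" where
  "frac_lap_const N s =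
     s * 2 powr (2 * s) * Gamma ((2 * s + real N) / 2) / (pi powr (real N / 2) * Gamma (1 - s))"

definition frac_form ::
  "real \<Rightarrow> ('a::euclidean_space \<Rightarrow> real) \<Rightarrow> ('a \<Rightarrow> real) \<Rightarrow> real" where
  "frac_form s u v = frac_lap_const DIM('a) s / 2 *
     (LINT (x, y)|lebesgue. (u x - u y) * (v x - v y) * gagliardo_kernel s x y)"

text \<open>The operator \<open>(-\<Delta>)^s_D\<close> from \<open>Ws2_0 s \<Omega>\<close> to its dual.\<close>

definition frac_lap_D ::
  "real \<Rightarrow> ('a::euclidean_space \<Rightarrow> real) \<Rightarrow> (('a \<Rightarrow> real) \<Rightarrow> real)" where
  "frac_lap_D s u = (\<lambda>v. frac_form s u v)"


section \<open>Time derivatives and the energy space\<close>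

definition time_test_functions :: "real \<Rightarrow> (real \<Rightarrow> real) set" where
  "time_test_functions T =
     {\<phi>. (\<forall>k t. (deriv ^^ k) \<phi> differentiable (at t)) \<and> closure {t. \<phi> t \<noteq> 0} \<subseteq> {0<..<T}}"

abbreviation L2_dual ::
  "real \<Rightarrow> real \<Rightarrow> 'a::euclidean_space set \<Rightarrow> (real \<Rightarrow> ('a \<Rightarrow> real) \<Rightarrow> real) set" where
  "L2_dual s T \<Omega> \<equiv> Bochner_Lp 2 T (Ws2_dual s \<Omega>) (Ws2_dual_norm s \<Omega>)"

text \<open>\<open>g\<close> is the distributional time derivative of \<open>h\<close>.  The defining identity between integrals in the
  dual space is evaluated at each \<open>v\<close>, evaluation being continuous and linear.\<close>

definition weak_time_derivative ::
  "real \<Rightarrow> real \<Rightarrow> 'a::euclidean_space set \<Rightarrow>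
     (real \<Rightarrow> ('a \<Rightarrow> real) \<Rightarrow> real) \<Rightarrow> (real \<Rightarrow> ('a \<Rightarrow> real) \<Rightarrow> real) \<Rightarrow> bool" where
  "weak_time_derivative s T \<Omega> h g \<longleftrightarrow>
     (\<forall>\<phi>\<in>time_test_functions T. \<forall>v\<in>Ws2_0 s \<Omega>.
        (LINT t|lebesgue_on {0<..<T}. deriv \<phi> t * h t v)
          = - (LINT t|lebesgue_on {0<..<T}. \<phi> t * g t v))"

definition H1_dual ::
  "real \<Rightarrow> real \<Rightarrow> 'a::euclidean_space set \<Rightarrow> (real \<Rightarrow> ('a \<Rightarrow> real) \<Rightarrow> real) set" where
  "H1_dual s T \<Omega> =
     {h \<in> L2_dual s T \<Omega>. \<exists>g \<in> L2_dual s T \<Omega>. weak_time_derivative s T \<Omega> h g}"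

text \<open>A space-time function as a function of time with values in the dual, by means of the pivot space
  \<open>L^2(\<Omega>)\<close>.\<close>

definition pivot_embed ::
  "'a::euclidean_space set \<Rightarrow> (real \<times> 'a \<Rightarrow> real) \<Rightarrow> real \<Rightarrow> ('a \<Rightarrow> real) \<Rightarrow> real" where
  "pivot_embed \<Omega> u t = L2_pairing \<Omega> (curry u t)"

definition U0_space ::
  "real \<Rightarrow> real \<Rightarrow> 'a::euclidean_space set \<Rightarrow> (real \<times> 'a \<Rightarrow> real) set" where
  "U0_space s T \<Omega> =
     {u \<in> borel_measurable (lebesgue_on ({0<..<T} \<times> UNIV)).
        curry u \<in> Bochner_Lp 2 T (Ws2_0 s \<Omega>) (Ws2_norm s) \<and>
        pivot_embed \<Omega> u \<in> H1_dual s T \<Omega>}"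


section \<open>The state equation\<close>

text \<open>\<open>\<partial>\<^sub>t u + (-\<Delta>)^s_D u = z\<close> in the dual for almost every time.\<close>

definition parabolic_equation ::
  "real \<Rightarrow> real \<Rightarrow> 'a::euclidean_space set \<Rightarrow>
     (real \<times> 'a \<Rightarrow> real) \<Rightarrow> (real \<times> 'a \<Rightarrow> real) \<Rightarrow> bool" where
  "parabolic_equation s T \<Omega> u z \<longleftrightarrow>
     (\<exists>g \<in> L2_dual s T \<Omega>. weak_time_derivative s T \<Omega> (pivot_embed \<Omega> u) g \<and>
        (\<forall>v\<in>Ws2_0 s \<Omega>. AE t in lebesgue_on {0<..<T}.
            g t v + frac_lap_D s (curry u t) v = pivot_embed \<Omega> z t v))"

text \<open>The initial value of an element of the energy space is the value at \<open>0\<close> of its representative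
  \<open>w\<close> in \<open>C([0,T]; L^2(\<Omega>))\<close>.\<close>

definition zero_initial_value ::
  "real \<Rightarrow> 'a::euclidean_space set \<Rightarrow> (real \<times> 'a \<Rightarrow> real) \<Rightarrow> bool" where
  "zero_initial_value T \<Omega> u \<longleftrightarrow>
     (\<exists>w. (\<forall>t\<in>{0..T}. w t \<in> Lp 2 \<Omega> \<and>
             ((\<lambda>\<tau>. Lp_norm 2 \<Omega> (w \<tau> - w t)) \<longlongrightarrow> 0) (at t within {0..T})) \<and>
          (AE t in lebesgue_on {0<..<T}. AE x in lebesgue_on \<Omega>. u (t, x) = w t x) \<and>
          (AE x in lebesgue_on \<Omega>. w 0 x = 0))"

definition state_equation ::
  "real \<Rightarrow> real \<Rightarrow> 'a::euclidean_space set \<Rightarrow>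
     (real \<times> 'a \<Rightarrow> real) \<Rightarrow> (real \<times> 'a \<Rightarrow> real) \<Rightarrow> bool" where
  "state_equation s T \<Omega> u z \<longleftrightarrow>
     u \<in> U0_space s T \<Omega> \<and> zero_initial_value T \<Omega> u \<and> parabolic_equation s T \<Omega> u z"

definition U_space ::
  "real \<Rightarrow> real \<Rightarrow> real \<Rightarrow> real \<Rightarrow> 'a::euclidean_space set \<Rightarrow> (real \<times> 'a \<Rightarrow> real) set" where
  "U_space s r p T \<Omega> =
     {u \<in> U0_space s T \<Omega>.
        (\<exists>w. continuous_on (closure (space_time_cylinder T \<Omega>)) w \<and>
             (AE q in lebesgue_on (space_time_cylinder T \<Omega>). u q = w q)) \<and>
        (\<exists>z \<in> LrLp r p T \<Omega>. parabolic_equation s T \<Omega> u z)}"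


section \<open>The regularized optimal control problem\<close>

definition regularized_cost ::
  "(real \<times> 'a::euclidean_space) set \<Rightarrow> (real \<times> 'a \<Rightarrow> real) \<Rightarrow> real \<Rightarrow> (real \<times> 'a \<Rightarrow> real) \<Rightarrow> real \<Rightarrow>
     (real \<times> 'a \<Rightarrow> real) \<Rightarrow> (real \<times> 'a \<Rightarrow> real) \<Rightarrow> real" where
  "regularized_cost Q u\<^sub>d \<alpha> \<mu> \<gamma> u z =
     1 / 2 * (Lp_norm 2 Q (\<lambda>q. u q - u\<^sub>d q))\<^sup>2
     + \<alpha> / 2 * (Lp_norm 2 Q z)\<^sup>2
     + 1 / (2 * \<gamma>) * (Lp_norm 2 Q (\<lambda>q. max 0 (\<mu> q + \<gamma> * u q)))\<^sup>2"

definition feasible ::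
  "real \<Rightarrow> real \<Rightarrow> real \<Rightarrow> real \<Rightarrow> 'a::euclidean_space set \<Rightarrow> (real \<times> 'a \<Rightarrow> real) set \<Rightarrow>
     (real \<times> 'a \<Rightarrow> real) \<Rightarrow> (real \<times> 'a \<Rightarrow> real) \<Rightarrow> bool" where
  "feasible s r p T \<Omega> Z\<^sub>a\<^sub>d u z \<longleftrightarrow>
     u \<in> U_space s r p T \<Omega> \<and> z \<in> LrLp r p T \<Omega> \<and> state_equation s T \<Omega> u z \<and> z \<in> Z\<^sub>a\<^sub>d"

definition solves_regularized_problem ::
  "real \<Rightarrow> real \<Rightarrow> real \<Rightarrow> real \<Rightarrow> 'a::euclidean_space set \<Rightarrow> (real \<times> 'a \<Rightarrow> real) set \<Rightarrow>
     (real \<times> 'a \<Rightarrow> real) \<Rightarrow> real \<Rightarrow> (real \<times> 'a \<Rightarrow> real) \<Rightarrow> real \<Rightarrow>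
     (real \<times> 'a \<Rightarrow> real) \<Rightarrow> (real \<times> 'a \<Rightarrow> real) \<Rightarrow> bool" where
  "solves_regularized_problem s r p T \<Omega> Z\<^sub>a\<^sub>d u\<^sub>d \<alpha> \<mu> \<gamma> u\<^sub>\<gamma> z\<^sub>\<gamma> \<longleftrightarrow>
     feasible s r p T \<Omega> Z\<^sub>a\<^sub>d u\<^sub>\<gamma> z\<^sub>\<gamma> \<and>
     (\<forall>u z. feasible s r p T \<Omega> Z\<^sub>a\<^sub>d u z \<longrightarrow>
        regularized_cost (space_time_cylinder T \<Omega>) u\<^sub>d \<alpha> \<mu> \<gamma> u\<^sub>\<gamma> z\<^sub>\<gamma>
          \<le> regularized_cost (space_time_cylinder T \<Omega>) u\<^sub>d \<alpha> \<mu> \<gamma> u z)"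

end

theory Submission
  imports Defs
begin

text \<open>
  The proof compares the optimal pair with the admissible pair \<open>(0, 0)\<close>, which is feasible because
  \<open>0\<close> is an admissible control and the zero state solves the state equation with zero source.  Write
  \<open>u\<close> for the optimal state and \<open>u\<^sub>+\<close> for its positive part.  Dropping the control cost, optimality
  yields
  \<open>1/2 \<parallel>u - u\<^sub>d\<parallel>\<^sup>2 + 1/(2\<gamma>) \<parallel>(\<mu> + \<gamma> u)\<^sub>+\<parallel>\<^sup>2 \<le> 1/2 \<parallel>u\<^sub>d\<parallel>\<^sup>2 + 1/(2\<gamma>) \<parallel>\<mu>\<^sub>+\<parallel>\<^sup>2\<close>.

  Two sign conditions give a lower bound for the left-hand side.  Since \<open>\<mu> \<ge> 0\<close>, the penalty term is at
  least \<open>\<gamma>/2 \<parallel>u\<^sub>+\<parallel>\<^sup>2\<close>, which already gives the rate \<open>\<gamma>\<close> to the power \<open>-1/2\<close>.  The full rate comes from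
  \<open>u\<^sub>d \<ge> 0\<close>: the tracking term can fall below \<open>1/2 \<parallel>u\<^sub>d\<parallel>\<^sup>2\<close> by at most \<open>(u, u\<^sub>d) \<le> (u\<^sub>+, u\<^sub>d)\<close>,
  a quantity that is itself controlled by \<open>u\<^sub>+\<close>.  Young's inequality with weight \<open>\<gamma>\<close> absorbs it
  into half of the penalty, at the price of \<open>\<parallel>u\<^sub>d\<parallel>\<^sup>2 / \<gamma>\<close>.  Multiplication by \<open>4 / \<gamma>\<close> leaves
  \<open>\<parallel>u\<^sub>+\<parallel>\<^sup>2 \<le> (4 \<parallel>u\<^sub>d\<parallel>\<^sup>2 + 2 \<parallel>\<mu>\<^sub>+\<parallel>\<^sup>2) / \<gamma>\<^sup>2\<close>.

  The lower bounds hold pointwise almost everywhere, by \<open>tracking_penalty_lower_bound\<close>; the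
  integrated version is \<open>positive_part_bound\<close>.  The integrals are meaningful because a state in \<open>U\<close>
  has a continuous representative on the compact closure of the space-time cylinder, hence is square
  integrable (\<open>U_space_imp_L2\<close>).
\<close>

section \<open>Square integrable functions\<close>

lemma Lp_2_iff:
  "f \<in> Lp 2 A \<longleftrightarrow>
     f \<in> borel_measurable (lebesgue_on A) \<and> integrable (lebesgue_on A) (\<lambda>x. (f x)\<^sup>2)"
  by (simp add: Lp_def)

lemma Lp_norm_2_power2: "(Lp_norm 2 A f)\<^sup>2 = (LINT x|lebesgue_on A. (f x)\<^sup>2)"
proof -
  have "0 \<le> (LINT x|lebesgue_on A. (f x)\<^sup>2)"
    by (rule integral_nonneg_AE) simp
  then show ?thesis
    by (simp add: Lp_norm_def powr_half_sqrt)
qed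

lemma Lp_norm_nonneg: "0 \<le> Lp_norm p A f"
  by (simp add: Lp_norm_def)

lemma zero_mem_Lp: "(\<lambda>_. 0) \<in> Lp p A"
  by (simp add: Lp_def)

lemma Lp_norm_zero [simp]: "Lp_norm p A (\<lambda>_. 0) = 0"
  by (simp add: Lp_norm_def)

lemma Lp_2_diff:
  assumes "f \<in> Lp 2 A" "g \<in> Lp 2 A"
  shows "(\<lambda>x. f x - g x) \<in> Lp 2 A"
proof -
  have [measurable]: "f \<in> borel_measurable (lebesgue_on A)" "g \<in> borel_measurable (lebesgue_on A)"
    and int: "integrable (lebesgue_on A) (\<lambda>x. 2 * (f x)\<^sup>2 + 2 * (g x)\<^sup>2)"
    using assms by (auto simp: Lp_2_iff)
  have "(f x - g x)\<^sup>2 \<le> 2 * (f x)\<^sup>2 + 2 * (g x)\<^sup>2" for x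
    using zero_le_power2[of "f x + g x"] by (simp add: power2_eq_square algebra_simps)
  then have "integrable (lebesgue_on A) (\<lambda>x. (f x - g x)\<^sup>2)"
    by (intro Bochner_Integration.integrable_bound[OF int]) (auto intro!: AE_I2)
  then show ?thesis by (simp add: Lp_2_iff)
qed

lemma Lp_2_cmult: "f \<in> Lp 2 A \<Longrightarrow> (\<lambda>x. c * f x) \<in> Lp 2 A" for c :: real
  by (auto simp: Lp_2_iff power_mult_distrib)

lemma Lp_2_add:
  assumes "f \<in> Lp 2 A" "g \<in> Lp 2 A"
  shows "(\<lambda>x. f x + g x) \<in> Lp 2 A"
  using Lp_2_diff[OF assms(1) Lp_2_cmult[OF assms(2), of "-1"]] by simp

lemma Lp_2_positive_part:
  assumes "f \<in> Lp 2 A"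
  shows "(\<lambda>x. max 0 (f x)) \<in> Lp 2 A"
proof -
  have [measurable]: "f \<in> borel_measurable (lebesgue_on A)"
    and int: "integrable (lebesgue_on A) (\<lambda>x. (f x)\<^sup>2)"
    using assms by (auto simp: Lp_2_iff)
  have "integrable (lebesgue_on A) (\<lambda>x. (max 0 (f x))\<^sup>2)"
    by (intro Bochner_Integration.integrable_bound[OF int]) (auto intro!: AE_I2 simp: max_def)
  then show ?thesis by (simp add: Lp_2_iff)
qed

section \<open>The pair of zero functions is feasible\<close>

lemma const_mem_Bochner_Lp:
  fixes c :: "'v::minus"
  assumes "c \<in> V" and "\<nu> (c - c) = 0"
  shows "(\<lambda>_. c) \<in> Bochner_Lp q T V \<nu>"
proof -
  interpret finite_measure "lebesgue_on {0<..<T}"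
    by (rule finite_measure_lebesgue_on) simp
  have "strongly_measurable_on T V \<nu> (\<lambda>_. c)"
    unfolding strongly_measurable_on_def
    by (rule exI[of _ "\<lambda>_ _. c"]) (use assms in auto)
  then show ?thesis
    using assms by (simp add: Bochner_Lp_def)
qed

lemma zero_mem_Ws2_0: "(\<lambda>_. 0) \<in> Ws2_0 s \<Omega>"
  by (simp add: Ws2_0_def Ws2_def zero_mem_Lp split_def)

lemma Ws2_norm_zero [simp]: "Ws2_norm s (\<lambda>_. 0) = 0"
  by (simp add: Ws2_norm_def split_def)

lemma zero_mem_Ws2_dual: "(\<lambda>_. 0) \<in> Ws2_dual s \<Omega>"
  by (auto simp: Ws2_dual_def intro: exI[of _ 0])

text \<open>A supremum of reals over the empty set is unspecified, so the zero test function is needed to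
  make the unit ball inhabited.\<close>

lemma Ws2_dual_norm_zero [simp]: "Ws2_dual_norm s \<Omega> (\<lambda>_. 0) = 0"
proof -
  have "{v \<in> Ws2_0 s \<Omega>. Ws2_norm s v \<le> 1} \<noteq> {}"
    using zero_mem_Ws2_0[of s \<Omega>] by (auto intro!: exI[of _ "\<lambda>_. 0"])
  then show ?thesis
    by (simp add: Ws2_dual_norm_def)
qed

lemma zero_mem_L2_dual: "(\<lambda>_ _. 0) \<in> L2_dual s T \<Omega>"
  by (rule const_mem_Bochner_Lp) (simp_all add: zero_mem_Ws2_dual zero_fun_def)

lemma pivot_embed_zero [simp]: "pivot_embed \<Omega> (\<lambda>_. 0) = (\<lambda>_ _. 0)"
  by (simp add: pivot_embed_def L2_pairing_def curry_def fun_eq_iff)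

lemma weak_time_derivative_zero: "weak_time_derivative s T \<Omega> (\<lambda>_ _. 0) (\<lambda>_ _. 0)"
  by (simp add: weak_time_derivative_def)

lemma zero_mem_U0_space: "(\<lambda>_. 0) \<in> U0_space s T \<Omega>"
proof -
  have "curry (\<lambda>_. 0) \<in> Bochner_Lp 2 T (Ws2_0 s \<Omega>) (Ws2_norm s)"
    unfolding curry_def
    by (rule const_mem_Bochner_Lp) (simp_all add: zero_mem_Ws2_0 zero_fun_def)
  moreover have "(\<lambda>_ _. 0) \<in> H1_dual s T \<Omega>"
    unfolding H1_dual_def
    by (auto intro: zero_mem_L2_dual weak_time_derivative_zero)
  ultimately show ?thesis
    by (simp add: U0_space_def)
qed

lemma parabolic_equation_zero: "parabolic_equation s T \<Omega> (\<lambda>_. 0) (\<lambda>_. 0)"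
  unfolding parabolic_equation_def
  by (rule bexI[OF _ zero_mem_L2_dual])
     (simp add: weak_time_derivative_zero frac_lap_D_def frac_form_def curry_def split_def)

lemma zero_initial_value_zero: "zero_initial_value T \<Omega> (\<lambda>_. 0)"
  unfolding zero_initial_value_def
  by (rule exI[of _ "\<lambda>_ _. 0"]) (simp add: zero_mem_Lp zero_fun_def)

lemma feasible_zero:
  assumes "(\<lambda>_. 0) \<in> LrLp r p T \<Omega>" and "(\<lambda>_. 0) \<in> Z\<^sub>a\<^sub>d"
  shows "feasible s r p T \<Omega> Z\<^sub>a\<^sub>d (\<lambda>_. 0) (\<lambda>_. 0)"
proof -
  have "(\<lambda>_. 0) \<in> U_space s r p T \<Omega>"
    unfolding U_space_def
    by (auto intro!: exI[of _ "\<lambda>_. 0"] bexI[OF _ assms(1)]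
          zero_mem_U0_space parabolic_equation_zero)
  then show ?thesis
    using assms
    by (simp add: feasible_def state_equation_def zero_mem_U0_space parabolic_equation_zero
          zero_initial_value_zero)
qed

section \<open>Square integrability of states\<close>

text \<open>The integral of a function that is not integrable is zero by convention, so a bound on a norm
  carries no information, and integrals cannot be compared, until integrability is known.  It comes
  from the continuous representative: this is bounded on the compact closure of the cylinder, and
  the cylinder has finite measure.\<close>

lemma U_space_imp_L2:
  fixes \<Omega> :: "'a::euclidean_space set"
  assumes "bounded \<Omega>" and "open \<Omega>" and u: "u \<in> U_space s r p T \<Omega>"
  shows "u \<in> Lp 2 (space_time_cylinder T \<Omega>)"
proof -
  define Q where "Q = space_time_cylinder T \<Omega>"
  have "bounded Q" and "open Q"
    using assms(1,2) by (auto simp: Q_def space_time_cylinder_def intro: bounded_Times open_Times)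
  then have Q: "Q \<in> lmeasurable"
    by (rule lmeasurable_open)
  interpret finite_measure "lebesgue_on Q"
    by (rule finite_measure_lebesgue_on[OF Q])
  have "u \<in> borel_measurable (lebesgue_on ({0<..<T} \<times> UNIV))"
    using u by (simp add: U_space_def U0_space_def)
  then have meas [measurable]: "u \<in> borel_measurable (lebesgue_on Q)"
    by (rule measurable_restrict_mono) (auto simp: Q_def space_time_cylinder_def)
  obtain w where w: "continuous_on (closure Q) w" and eq: "AE q in lebesgue_on Q. u q = w q"
    using u unfolding U_space_def Q_def by blast
  have "compact (w ` closure Q)"
    using w \<open>bounded Q\<close> by (intro compact_continuous_image) auto
  then obtain B where B: "\<And>q. q \<in> closure Q \<Longrightarrow> \<bar>w q\<bar> \<le> B"
    by (metis compact_imp_bounded bounded_iff imageI real_norm_def)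
  have "AE q in lebesgue_on Q. norm ((u q)\<^sup>2) \<le> B\<^sup>2"
    using eq
  proof (rule AE_mp, intro AE_I2 impI)
    fix q assume "q \<in> space (lebesgue_on Q)" and "u q = w q"
    then have "q \<in> closure Q"
      using closure_subset by auto
    then show "norm ((u q)\<^sup>2) \<le> B\<^sup>2"
      using power_mono[OF B, of q 2] \<open>u q = w q\<close> by simp
  qed
  then have "integrable (lebesgue_on Q) (\<lambda>q. (u q)\<^sup>2)"
    by (intro integrable_const_bound[where B = "B\<^sup>2"]) auto
  with meas show ?thesis
    by (simp add: Lp_2_iff Q_def)
qed

section \<open>The estimate of the constraint violation\<close>

text \<open>Here \<open>a\<close>, \<open>d\<close>, \<open>m\<close> stand for the values of the state, the desired state and the shift at a
  point.  The penalty contributes \<open>\<gamma> / 2\<close> times the square of the positive part of \<open>a\<close>, because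
  adding \<open>m \<ge> 0\<close> only increases it; half of this pays for the cross term \<open>a * d\<close> of the
  tracking square.\<close>

lemma tracking_penalty_lower_bound:
  fixes a d m \<gamma> :: real
  assumes "0 < \<gamma>" and "0 \<le> d" and "0 \<le> m"
  shows "1 / 2 * d\<^sup>2 + \<gamma> / 4 * (max 0 a)\<^sup>2 - 1 / \<gamma> * d\<^sup>2
           \<le> 1 / 2 * (a - d)\<^sup>2 + 1 / (2 * \<gamma>) * (max 0 (m + \<gamma> * a))\<^sup>2"
proof -
  define b where "b = max 0 a"
  have "\<gamma> * b \<le> max 0 (m + \<gamma> * a)"
    using assms by (auto simp: b_def max_def)
  then have "(\<gamma> * b)\<^sup>2 \<le> (max 0 (m + \<gamma> * a))\<^sup>2"
    using assms by (intro power_mono) (auto simp: b_def)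
  then have "1 / (2 * \<gamma>) * (\<gamma> * b)\<^sup>2 \<le> 1 / (2 * \<gamma>) * (max 0 (m + \<gamma> * a))\<^sup>2"
    using assms by (intro mult_left_mono) auto
  then have penalty: "\<gamma> / 2 * b\<^sup>2 \<le> 1 / (2 * \<gamma>) * (max 0 (m + \<gamma> * a))\<^sup>2"
    using assms by (simp add: power2_eq_square mult_ac)
  have "a * d \<le> b * d"
    using assms by (intro mult_right_mono) (auto simp: b_def)
  \<comment> \<open>Young's inequality, with the weight chosen to cost half of the penalty.\<close>
  also have "b * d \<le> \<gamma> / 4 * b\<^sup>2 + 1 / \<gamma> * d\<^sup>2"
  proof -
    have "0 \<le> 1 / \<gamma> * (\<gamma> / 2 * b - d)\<^sup>2"
      using assms by simp
    also have "\<dots> = \<gamma> / 4 * b\<^sup>2 + 1 / \<gamma> * d\<^sup>2 - b * d"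
      using assms by (simp add: power2_eq_square field_simps)
    finally show ?thesis by simp
  qed
  finally have cross: "a * d \<le> \<gamma> / 4 * b\<^sup>2 + 1 / \<gamma> * d\<^sup>2" .
  have "1 / 2 * (a - d)\<^sup>2 \<ge> 1 / 2 * d\<^sup>2 - a * d"
    by (simp add: power2_eq_square algebra_simps)
  with penalty cross show ?thesis
    by (simp add: b_def)
qed

text \<open>Integrating the pointwise bound and subtracting the cost of the zero pair cancels the two terms
  \<open>1/2 \<parallel>u\<^sub>d\<parallel>\<^sup>2\<close>, which do not decay in \<open>\<gamma>\<close>; everything that remains opposite to
  \<open>\<gamma> / 4 \<parallel>u\<^sub>+\<parallel>\<^sup>2\<close> carries a factor \<open>1 / \<gamma>\<close>.\<close>

lemma positive_part_bound:
  fixes Q :: "(real \<times> 'a::euclidean_space) set"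
  assumes "0 < \<gamma>" and "0 \<le> \<alpha>"
    and u: "u \<in> Lp 2 Q" and d: "u\<^sub>d \<in> Lp 2 Q" and m: "\<mu> \<in> Lp 2 Q"
    and d_nonneg: "AE q in lebesgue_on Q. 0 \<le> u\<^sub>d q"
    and m_nonneg: "AE q in lebesgue_on Q. 0 \<le> \<mu> q"
    and cost: "regularized_cost Q u\<^sub>d \<alpha> \<mu> \<gamma> u z
                 \<le> regularized_cost Q u\<^sub>d \<alpha> \<mu> \<gamma> (\<lambda>_. 0) (\<lambda>_. 0)"
  shows "Lp_norm 2 Q (\<lambda>q. max 0 (u q))
           \<le> sqrt (4 * (Lp_norm 2 Q u\<^sub>d)\<^sup>2 + 2 * (Lp_norm 2 Q (\<lambda>q. max 0 (\<mu> q)))\<^sup>2) / \<gamma>"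
proof -
  let ?I = "\<lambda>f. LINT q|lebesgue_on Q. (f q)\<^sup>2"
  define P where "P = (\<lambda>q. max 0 (u q))"
  define R where "R = (\<lambda>q. max 0 (\<mu> q + \<gamma> * u q))"
  define M where "M = (\<lambda>q. max 0 (\<mu> q))"
  have int: "integrable (lebesgue_on Q) (\<lambda>q. (P q)\<^sup>2)"
    "integrable (lebesgue_on Q) (\<lambda>q. (R q)\<^sup>2)"
    "integrable (lebesgue_on Q) (\<lambda>q. (u q - u\<^sub>d q)\<^sup>2)"
    "integrable (lebesgue_on Q) (\<lambda>q. (u\<^sub>d q)\<^sup>2)"
    using Lp_2_positive_part[OF u] Lp_2_positive_part[OF Lp_2_add[OF m Lp_2_cmult[OF u]]]
      Lp_2_diff[OF u d] d
    by (auto simp: Lp_2_iff P_def R_def)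
  have "(LINT q|lebesgue_on Q. 1 / 2 * (u\<^sub>d q)\<^sup>2 + \<gamma> / 4 * (P q)\<^sup>2 - 1 / \<gamma> * (u\<^sub>d q)\<^sup>2)
          \<le> (LINT q|lebesgue_on Q. 1 / 2 * (u q - u\<^sub>d q)\<^sup>2 + 1 / (2 * \<gamma>) * (R q)\<^sup>2)"
  proof (rule integral_mono_AE)
    show "AE q in lebesgue_on Q. 1 / 2 * (u\<^sub>d q)\<^sup>2 + \<gamma> / 4 * (P q)\<^sup>2 - 1 / \<gamma> * (u\<^sub>d q)\<^sup>2
            \<le> 1 / 2 * (u q - u\<^sub>d q)\<^sup>2 + 1 / (2 * \<gamma>) * (R q)\<^sup>2"
      using d_nonneg m_nonneg
      by eventually_elim
         (unfold P_def R_def, rule tracking_penalty_lower_bound[OF \<open>0 < \<gamma>\<close>])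
  qed (intro Bochner_Integration.integrable_add Bochner_Integration.integrable_diff
        integrable_mult_right int)+
  then have lower: "1 / 2 * ?I u\<^sub>d + \<gamma> / 4 * ?I P - 1 / \<gamma> * ?I u\<^sub>d
          \<le> 1 / 2 * ?I (\<lambda>q. u q - u\<^sub>d q) + 1 / (2 * \<gamma>) * ?I R"
    using int by simp
  have "0 \<le> \<alpha> / 2 * ?I z"
    using \<open>0 \<le> \<alpha>\<close> by (intro mult_nonneg_nonneg integral_nonneg_AE) auto
  with cost have upper: "1 / 2 * ?I (\<lambda>q. u q - u\<^sub>d q) + 1 / (2 * \<gamma>) * ?I R
          \<le> 1 / 2 * ?I u\<^sub>d + 1 / (2 * \<gamma>) * ?I M"
    by (simp add: regularized_cost_def Lp_norm_2_power2 R_def M_def)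
  have "\<gamma> / 4 * ?I P \<le> 1 / \<gamma> * ?I u\<^sub>d + 1 / (2 * \<gamma>) * ?I M"
    using lower upper by linarith
  then have "4 * \<gamma> * (\<gamma> / 4 * ?I P) \<le> 4 * \<gamma> * (1 / \<gamma> * ?I u\<^sub>d + 1 / (2 * \<gamma>) * ?I M)"
    using \<open>0 < \<gamma>\<close> by (intro mult_left_mono) auto
  moreover have "4 * \<gamma> * (\<gamma> / 4 * ?I P) = (\<gamma> * Lp_norm 2 Q P)\<^sup>2"
    unfolding power_mult_distrib Lp_norm_2_power2 by (simp add: power2_eq_square)
  moreover have "4 * \<gamma> * (1 / \<gamma> * ?I u\<^sub>d + 1 / (2 * \<gamma>) * ?I M) = 4 * ?I u\<^sub>d + 2 * ?I M"
    using \<open>0 < \<gamma>\<close> by (simp add: field_simps)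
  ultimately have "(\<gamma> * Lp_norm 2 Q P)\<^sup>2 \<le> 4 * (Lp_norm 2 Q u\<^sub>d)\<^sup>2 + 2 * (Lp_norm 2 Q M)\<^sup>2"
    by (simp add: Lp_norm_2_power2)
  then have "\<gamma> * Lp_norm 2 Q P \<le> sqrt (4 * (Lp_norm 2 Q u\<^sub>d)\<^sup>2 + 2 * (Lp_norm 2 Q M)\<^sup>2)"
    by (rule real_le_rsqrt)
  then show ?thesis
    using \<open>0 < \<gamma>\<close> by (simp add: P_def M_def pos_le_divide_eq mult.commute)
qed

theorem theorem5p3:
  fixes \<Omega> :: "'a::euclidean_space set"
    and s T p r \<alpha> :: real
    and Z\<^sub>a\<^sub>d :: "(real \<times> 'a \<Rightarrow> real) set"
    and u\<^sub>d \<mu> :: "real \<times> 'a \<Rightarrow> real"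
    and u z :: "real \<Rightarrow> real \<times> 'a \<Rightarrow> real"
  assumes "bounded \<Omega>" and "open \<Omega>"
    and "lipschitz_boundary \<Omega>" and "exterior_ball_condition \<Omega>"
    and "0 < s" and "s < 1" and "0 < T"
    and "2 \<le> p" and "2 \<le> r" and "1 > real DIM('a) / (2 * p * s) + 1 / r"
    and "Z\<^sub>a\<^sub>d \<subseteq> LrLp r p T \<Omega>" and "Z\<^sub>a\<^sub>d \<noteq> {}"
    and "norm_closed_in (LrLp r p T \<Omega>) (LrLp_norm r p T \<Omega>) Z\<^sub>a\<^sub>d"
    and "convex_function_set Z\<^sub>a\<^sub>d"
    and "u\<^sub>d \<in> Lp 2 (space_time_cylinder T \<Omega>)" and "0 < \<alpha>"
    and "\<mu> \<in> Lp 2 (space_time_cylinder T \<Omega>)" and "AE q in lebesgue_on (space_time_cylinder T \<Omega>). 0 \<le> \<mu> q"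
    and "\<And>\<gamma>. 0 < \<gamma> \<Longrightarrow> solves_regularized_problem s r p T \<Omega> Z\<^sub>a\<^sub>d u\<^sub>d \<alpha> \<mu> \<gamma> (u \<gamma>) (z \<gamma>)"
    and "(\<lambda>_. 0) \<in> Z\<^sub>a\<^sub>d"
    and "AE q in lebesgue_on (space_time_cylinder T \<Omega>). 0 \<le> u\<^sub>d q"
  shows "(\<lambda>\<gamma>. Lp_norm 2 (space_time_cylinder T \<Omega>) (\<lambda>q. max 0 (u \<gamma> q))) \<in> O[at_top](\<lambda>\<gamma>. 1 / \<gamma>)"
proof -
  define Q where "Q = space_time_cylinder T \<Omega>"
  define C where "C = sqrt (4 * (Lp_norm 2 Q u\<^sub>d)\<^sup>2 + 2 * (Lp_norm 2 Q (\<lambda>q. max 0 (\<mu> q)))\<^sup>2)"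
  have zero: "feasible s r p T \<Omega> Z\<^sub>a\<^sub>d (\<lambda>_. 0) (\<lambda>_. 0)"
    using \<open>Z\<^sub>a\<^sub>d \<subseteq> LrLp r p T \<Omega>\<close> \<open>(\<lambda>_. 0) \<in> Z\<^sub>a\<^sub>d\<close> by (intro feasible_zero) auto
  have bound: "Lp_norm 2 Q (\<lambda>q. max 0 (u \<gamma> q)) \<le> C / \<gamma>" if "0 < \<gamma>" for \<gamma>
  proof -
    have sol: "solves_regularized_problem s r p T \<Omega> Z\<^sub>a\<^sub>d u\<^sub>d \<alpha> \<mu> \<gamma> (u \<gamma>) (z \<gamma>)"
      by (rule assms(19)[OF that])
    then have "u \<gamma> \<in> Lp 2 Q"
      unfolding Q_def using \<open>bounded \<Omega>\<close> \<open>open \<Omega>\<close>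
      by (intro U_space_imp_L2) (auto simp: solves_regularized_problem_def feasible_def)
    moreover have "regularized_cost Q u\<^sub>d \<alpha> \<mu> \<gamma> (u \<gamma>) (z \<gamma>)
        \<le> regularized_cost Q u\<^sub>d \<alpha> \<mu> \<gamma> (\<lambda>_. 0) (\<lambda>_. 0)"
      using sol zero by (simp add: solves_regularized_problem_def Q_def)
    ultimately show ?thesis
      unfolding C_def using that \<open>0 < \<alpha>\<close> assms(15,17,18,21)[folded Q_def]
      by (intro positive_part_bound) auto
  qed
  show ?thesis
  proof (rule bigoI[of _ C])
    show "\<forall>\<^sub>F \<gamma> in at_top. norm (Lp_norm 2 (space_time_cylinder T \<Omega>) (\<lambda>q. max 0 (u \<gamma> q)))
            \<le> C * norm (1 / \<gamma>)"
      using eventually_gt_at_top[of 0]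
      by eventually_elim (use bound in \<open>simp add: Q_def Lp_norm_nonneg\<close>)
  qed
qed

end
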